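(* Let $\mathcal{G}$ be a temporal graph with $m\ge 1$ snapshots on $n$ vertices, with snapshot Laplacians $L_1,\dots,L_m$, and let $\beta$ be a real constant. Let $\mathcal{M}_S=3(n+2\beta)\mathcal{C}-\mathcal{L}$. For each $t$, let $M_t=3(n+2\beta)C-L_t=U_t\Lambda_tU_t^{\intercal}$ be an eigendecomposition ($U_t$ orthogonal, $\Lambda_t$ diagonal), and let $\mathbf{\Lambda}=\mathbf{diag}(\Lambda_1,\dots,\Lambda_m)$ and $\mathcal{U}=\mathbf{diag}(U_1,\dots,U_m)$. Define the $nm\times nm$ matrix $$\mathcal{Q}=\mathbf{\Lambda}-\beta\begin{pmatrix} I & -U_1^{\intercal}U_2 & 0 & \cdots & 0\\ -U_2^{\intercal}U_1 & 2I & -U_2^{\intercal}U_3 & \cdots & 0\\ \vdots & & \ddots & & -U_{m-1}^{\intercal}U_m\\ 0 & 0 & \cdots & -U_m^{\intercal}U_{m-1} & I\end{pmatrix},$$ i.e. the matrix multiplied by $\beta$ is block tridiagonal with $(t,t)$ block $(L^I)_{t,t}\,I_n$, with $(t,t+1)$ block $-U_t^{\intercal}U_{t+1}$ and with $(t+1,t)$ block $-U_{t+1}^{\intercal}U_t$. Then the eigenvalues of $\mathcal{M}_S$ are the same as those of $\mathcal{Q}$, and the eigenvectors of $\mathcal{M}_S$ are obtained as $\mathcal{U}\,\mathbf{e}^{\mathcal{Q}}$, where $\mathbf{e}^{\mathcal{Q}}$ is the corresponding eigenvector of $\mathcal{Q}$ (for the same eigenvalue).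
   Context: A temporal graph $\mathcal{G}=\langle G_1,\dots,G_m\rangle$ is a sequence of undirected weighted graphs (snapshots) $G_t=(V,E_t,W_t)$ on a common vertex set $V$ with $|V|=n$, with $W_t:E_t\to\mathbb{R}$. Let $L_t=D_t-A_t$ be the weighted Laplacian of $G_t$ (weighted degree matrix minus weighted adjacency matrix). The Laplacian of the temporal graph is $\mathcal{L}=\mathbf{diag}(L_1,\dots,L_m)+\beta\,(L^I\otimes I_n)$, where $L^I$ is the $m\times m$ unweighted Laplacian of the path graph on $1,\dots,m$ (for $m\ge2$: diagonal $1,2,\dots,2,1$ and $-1$ on the sub- and superdiagonals; for $m=1$: the zero matrix). Let $C=nI_n-\mathbf{1}_{n\times n}$, where $\mathbf{1}_{n\times n}$ is the all-ones matrix, and $\mathcal{C}=I_m\otimes C$. *)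

theory Defs
  imports "Jordan_Normal_Form.Char_Poly"
begin

(* Vertices are 0, ..., n - 1. An edge is a two-element vertex set, so there are no loops.
   Weights are arbitrary reals; values of weight outside edges are irrelevant. *)
record weighted_graph =
  edges :: "nat set set"
  weight :: "nat set \<Rightarrow> real"

definition weighted_graph_on :: "nat \<Rightarrow> weighted_graph \<Rightarrow> bool" where
  "weighted_graph_on n g \<longleftrightarrow> edges g \<subseteq> {{u, v} | u v. u < n \<and> v < n \<and> u \<noteq> v}"

definition adjacency_matrix :: "nat \<Rightarrow> weighted_graph \<Rightarrow> real mat" where
  "adjacency_matrix n g =
     mat n n (\<lambda>(u, v). if {u, v} \<in> edges g then weight g {u, v} else 0)"

definition degree_matrix :: "nat \<Rightarrow> weighted_graph \<Rightarrow> real mat" where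
  "degree_matrix n g =
     mat n n (\<lambda>(u, v). if u = v then \<Sum>w<n. adjacency_matrix n g $$ (u, w) else 0)"

definition laplacian :: "nat \<Rightarrow> weighted_graph \<Rightarrow> real mat" where
  "laplacian n g = degree_matrix n g - adjacency_matrix n g"

definition path_graph :: "nat \<Rightarrow> weighted_graph" where
  "path_graph m = \<lparr>edges = {{i, Suc i} | i. Suc i < m}, weight = (\<lambda>_. 1)\<rparr>"

definition path_laplacian :: "nat \<Rightarrow> real mat" where
  "path_laplacian m = laplacian m (path_graph m)"

definition kronecker :: "real mat \<Rightarrow> real mat \<Rightarrow> real mat" where
  "kronecker A B =
     mat (dim_row A * dim_row B) (dim_col A * dim_col B)
       (\<lambda>(i, j). A $$ (i div dim_row B, j div dim_col B) * B $$ (i mod dim_row B, j mod dim_col B))"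

(* A temporal graph is the list of its snapshots; the number m of snapshots is the length. *)
definition temporal_graph_on :: "nat \<Rightarrow> weighted_graph list \<Rightarrow> bool" where
  "temporal_graph_on n G \<longleftrightarrow> G \<noteq> [] \<and> (\<forall>g \<in> set G. weighted_graph_on n g)"

definition temporal_laplacian :: "nat \<Rightarrow> real \<Rightarrow> weighted_graph list \<Rightarrow> real mat" where
  "temporal_laplacian n \<beta> G =
     diag_block_mat (map (laplacian n) G)
       + \<beta> \<cdot>\<^sub>m kronecker (path_laplacian (length G)) (1\<^sub>m n)"

definition complete_laplacian :: "nat \<Rightarrow> real mat" where
  "complete_laplacian n = real n \<cdot>\<^sub>m 1\<^sub>m n - mat n n (\<lambda>_. 1)"

definition temporal_complete_laplacian :: "nat \<Rightarrow> nat \<Rightarrow> real mat" where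
  "temporal_complete_laplacian m n = kronecker (1\<^sub>m m) (complete_laplacian n)"

definition M_S :: "nat \<Rightarrow> real \<Rightarrow> weighted_graph list \<Rightarrow> real mat" where
  "M_S n \<beta> G =
     (3 * (real n + 2 * \<beta>)) \<cdot>\<^sub>m temporal_complete_laplacian (length G) n
       - temporal_laplacian n \<beta> G"

definition M_snapshot :: "nat \<Rightarrow> real \<Rightarrow> weighted_graph \<Rightarrow> real mat" where
  "M_snapshot n \<beta> g =
     (3 * (real n + 2 * \<beta>)) \<cdot>\<^sub>m complete_laplacian n - laplacian n g"

(* Orthogonality of U is spelled out because orthogonal_mat in the library only asks for
   pairwise orthogonal nonzero columns, not for unit columns. *)
definition eigendecomposition :: "nat \<Rightarrow> real mat \<Rightarrow> real mat \<Rightarrow> real mat \<Rightarrow> bool" where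
  "eigendecomposition n M U D \<longleftrightarrow>
     U \<in> carrier_mat n n \<and> D \<in> carrier_mat n n \<and>
     transpose_mat U * U = 1\<^sub>m n \<and> U * transpose_mat U = 1\<^sub>m n \<and>
     diagonal_mat D \<and> M = U * D * transpose_mat U"

(* The block matrix with m x m blocks, all of size n x n, whose (s, t) block is B s t. *)
definition square_blocks_mat :: "nat \<Rightarrow> nat \<Rightarrow> (nat \<Rightarrow> nat \<Rightarrow> real mat) \<Rightarrow> real mat" where
  "square_blocks_mat m n B =
     mat (m * n) (m * n) (\<lambda>(i, j). B (i div n) (j div n) $$ (i mod n, j mod n))"

definition coupling_block :: "nat \<Rightarrow> nat \<Rightarrow> (nat \<Rightarrow> real mat) \<Rightarrow> nat \<Rightarrow> nat \<Rightarrow> real mat" where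
  "coupling_block m n U s t =
     (if s = t then path_laplacian m $$ (t, t) \<cdot>\<^sub>m 1\<^sub>m n
      else if t = Suc s \<or> s = Suc t then - (transpose_mat (U s) * U t)
      else 0\<^sub>m n n)"

definition Q_mat :: "nat \<Rightarrow> nat \<Rightarrow> real \<Rightarrow> (nat \<Rightarrow> real mat) \<Rightarrow> (nat \<Rightarrow> real mat) \<Rightarrow> real mat" where
  "Q_mat m n \<beta> U \<Lambda> =
     diag_block_mat (map \<Lambda> [0..<m]) - \<beta> \<cdot>\<^sub>m square_blocks_mat m n (coupling_block m n U)"

lemma path_edge_iff:
  "{i, j} \<in> edges (path_graph m) \<longleftrightarrow> (j = Suc i \<and> j < m) \<or> (i = Suc j \<and> i < m)"
  by (auto simp: path_graph_def doubleton_eq_iff)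

lemma path_laplacian_index:
  assumes "i < m" "j < m"
  shows "path_laplacian m $$ (i, j) =
    (if i = j then (if m = 1 then 0 else if i = 0 \<or> i = m - 1 then 1 else 2)
     else if j = Suc i \<or> i = Suc j then -1 else 0)"
proof -
  have A: "adjacency_matrix m (path_graph m) $$ (i, w) = (if w = Suc i \<or> i = Suc w then 1 else 0)"
    if "w < m" for w
    using that assms unfolding adjacency_matrix_def
    by (auto simp: path_edge_iff) (auto simp: path_graph_def)
  have "(\<Sum>w<m. adjacency_matrix m (path_graph m) $$ (i, w))
      = (\<Sum>w<m. if w \<in> {w. w = Suc i \<or> i = Suc w} then 1 else 0)"
    by (rule sum.cong) (auto simp: A)
  also have "\<dots> = real (card {w \<in> {..<m}. w = Suc i \<or> i = Suc w})"
    by (simp add: sum.If_cases Int_def)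
  also have "{w \<in> {..<m}. w = Suc i \<or> i = Suc w}
      = (if Suc i < m then {Suc i} else {}) \<union> (if i = 0 then {} else {i - 1})"
    using assms by auto
  also have "real (card \<dots>) = (if m = 1 then 0 else if i = 0 \<or> i = m - 1 then 1 else 2)"
    using assms by auto
  finally have D: "(\<Sum>w<m. adjacency_matrix m (path_graph m) $$ (i, w))
      = (if m = 1 then 0 else if i = 0 \<or> i = m - 1 then 1 else 2)" .
  show ?thesis
    using assms D A[of j]
    by (auto simp: path_laplacian_def laplacian_def degree_matrix_def adjacency_matrix_def)
qed

end

theory Submission
  imports Defs
begin

text \<open>With \<open>\<U>\<close> the block diagonal matrix of the \<open>U t\<close>, the \<open>(s, t)\<close> block of
  \<open>\<U> * Q * \<U>\<^sup>T\<close> is \<open>U s * Q s t * (U t)\<^sup>T\<close>: orthogonality cancels the coupling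
  blocks to \<open>-1\<close> times the identity, and the diagonal ones give the snapshot matrices. Hence
  \<open>M_S\<close> and \<open>Q\<close> are similar through the orthogonal matrix \<open>\<U>\<close>.\<close>

section \<open>Square block matrices\<close>

text \<open>Every k < m * n is r * n + i for exactly one r < m and i < n. The range is cut into m
  consecutive runs of length n, and each run is shifted back to start at 0.\<close>

lemma sum_div_mod:
  fixes f :: "nat \<Rightarrow> nat \<Rightarrow> 'a :: comm_monoid_add"
  shows "(\<Sum>k<m * n. f (k div n) (k mod n)) = (\<Sum>r<m. \<Sum>i<n. f r i)"
proof -
  have "(\<Sum>k<m * n. f (k div n) (k mod n))
      = (\<Sum>r<m. \<Sum>k = r * n..<r * n + n. f (k div n) (k mod n))"
    by (rule sum.nat_group[symmetric])
  also have "\<dots> = (\<Sum>r<m. \<Sum>i<n. f r i)"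
  proof (rule sum.cong[OF refl])
    fix r
    have "(\<Sum>k = r * n..<r * n + n. f (k div n) (k mod n))
        = (\<Sum>k = 0 + r * n..<n + r * n. f (k div n) (k mod n))"
      by (simp add: add.commute)
    also have "\<dots> = (\<Sum>i = 0..<n. f ((i + r * n) div n) ((i + r * n) mod n))"
      by (rule sum.shift_bounds_nat_ivl)
    also have "\<dots> = (\<Sum>i<n. f r i)"
      by (rule sum.cong) auto
    finally show "(\<Sum>k = r * n..<r * n + n. f (k div n) (k mod n)) = (\<Sum>i<n. f r i)" .
  qed
  finally show ?thesis .
qed

lemma square_blocks_mat_carrier [simp]:
  "square_blocks_mat m n B \<in> carrier_mat (m * n) (m * n)"
  by (simp add: square_blocks_mat_def)

lemma div_mod_less:
  fixes i m n :: nat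
  assumes "i < m * n"
  shows "i div n < m" "i mod n < n"
  \<comment> \<open>For n = 0 the bound \<open>m * n\<close> would be 0, so the assumption forces n
    > 0, as the bound on the remainder requires.\<close>
  using assms by (auto simp: less_mult_imp_div_less intro!: mod_less_divisor gr0I)

text \<open>Only blocks with both indices below m are ever read, so facts known just for the
  snapshots t < m suffice to rewrite blocks.\<close>

lemma square_blocks_mat_cong:
  assumes "\<And>s t i j. s < m \<Longrightarrow> t < m \<Longrightarrow> i < n \<Longrightarrow> j < n \<Longrightarrow> A s t $$ (i, j) = B s t $$ (i, j)"
  shows "square_blocks_mat m n A = square_blocks_mat m n B"
  unfolding square_blocks_mat_def
  by (rule cong_mat) (auto intro!: assms simp: div_mod_less)

text \<open>The inner index k splits into a block number r and a position inside the block, and the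
  sum over positions is an entry of a product of blocks. The form is entrywise because a
  \<open>sum\<close> of matrices would need a zero whose dimension is fixed in advance.\<close>

lemma square_blocks_mat_mult_index:
  assumes A: "\<And>s t. s < m \<Longrightarrow> t < m \<Longrightarrow> A s t \<in> carrier_mat n n"
    and B: "\<And>s t. s < m \<Longrightarrow> t < m \<Longrightarrow> B s t \<in> carrier_mat n n"
    and i: "i < m * n" and j: "j < m * n"
  shows "(square_blocks_mat m n A * square_blocks_mat m n B) $$ (i, j)
    = (\<Sum>r<m. (A (i div n) r * B r (j div n)) $$ (i mod n, j mod n))"
proof -
  note dm = div_mod_less[OF i] div_mod_less[OF j]
  have "(square_blocks_mat m n A * square_blocks_mat m n B) $$ (i, j)
    = (\<Sum>k<m * n. A (i div n) (k div n) $$ (i mod n, k mod n)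
        * B (k div n) (j div n) $$ (k mod n, j mod n))"
    using i j by (simp add: square_blocks_mat_def scalar_prod_def lessThan_atLeast0)
  also have "\<dots> = (\<Sum>r<m. \<Sum>k<n. A (i div n) r $$ (i mod n, k) * B r (j div n) $$ (k, j mod n))"
    by (rule sum_div_mod)
  also have "\<dots> = (\<Sum>r<m. (A (i div n) r * B r (j div n)) $$ (i mod n, j mod n))"
  proof (rule sum.cong[OF refl])
    fix r assume "r \<in> {..<m}"
    then have "A (i div n) r \<in> carrier_mat n n" "B r (j div n) \<in> carrier_mat n n"
      using A B dm by auto
    then show "(\<Sum>k<n. A (i div n) r $$ (i mod n, k) * B r (j div n) $$ (k, j mod n))
        = (A (i div n) r * B r (j div n)) $$ (i mod n, j mod n)"
      using dm by (simp add: scalar_prod_def lessThan_atLeast0)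
  qed
  finally show ?thesis .
qed

section \<open>Block diagonal matrices and their products with block matrices\<close>

lemma diag_block_mat_carrier:
  assumes "\<And>t. t < m \<Longrightarrow> F t \<in> carrier_mat n n"
  shows "diag_block_mat (map F [0..<m]) \<in> carrier_mat (m * n) (m * n)"
proof -
  have "map (\<lambda>t. dim_row (F t)) [0..<m] = map (\<lambda>_. n) [0..<m]"
    and "map (\<lambda>t. dim_col (F t)) [0..<m] = map (\<lambda>_. n) [0..<m]"
    using assms by (auto simp: carrier_matD[of _ n n])
  then show ?thesis
    by (intro carrier_matI)
      (simp_all only: dim_diag_block_mat map_map o_def, simp_all add: sum_list_triv)
qed

text \<open>Induction that peels off the first block, as the recursion of
  \<open>diag_block_mat\<close> does. The remaining blocks are \<open>F\<close> shifted by one,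
  hence \<open>F\<close> is arbitrary in the induction.\<close>

lemma diag_block_mat_eq_square_blocks:
  assumes "\<And>t. t < m \<Longrightarrow> F t \<in> carrier_mat n n"
  shows "diag_block_mat (map F [0..<m])
    = square_blocks_mat m n (\<lambda>s t. if s = t then F s else 0\<^sub>m n n)"
  using assms
proof (induction m arbitrary: F)
  case 0
  show ?case by (auto simp: square_blocks_mat_def)
next
  case (Suc m)
  have F0: "F 0 \<in> carrier_mat n n" and FS: "\<And>t. t < m \<Longrightarrow> F (Suc t) \<in> carrier_mat n n"
    using Suc.prems by auto
  let ?D = "square_blocks_mat m n (\<lambda>s t. if s = t then F (Suc s) else 0\<^sub>m n n)"
  have D: "diag_block_mat (map (\<lambda>t. F (Suc t)) [0..<m]) = ?D"
    using Suc.IH[of "\<lambda>t. F (Suc t)"] FS by simp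
  have "map F [0..<Suc m] = F 0 # map (\<lambda>t. F (Suc t)) [0..<m]"
    by (simp add: upt_conv_Cons map_Suc_upt[symmetric] del: upt_Suc)
  then have E: "diag_block_mat (map F [0..<Suc m])
      = four_block_mat (F 0) (0\<^sub>m n (m * n)) (0\<^sub>m (m * n) n) ?D"
    using F0 by (simp add: D Let_def square_blocks_mat_def del: upt_Suc)
  show ?case
  proof (rule eq_matI, goal_cases)
    case (1 i j)
    then have ij: "i < n + m * n" "j < n + m * n" by (auto simp: square_blocks_mat_def)
    \<comment> \<open>Past the first block, subtracting n lowers the block number by one and keeps
      the position. This matches the offsets of \<open>four_block_mat\<close> with the indexing by
      \<open>div\<close> and \<open>mod\<close>.\<close>
    have sub: "k div n = Suc ((k - n) div n) \<and> k mod n = (k - n) mod n \<and> k - n < m * n"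
      if "n \<le> k" "k < n + m * n" for k
    proof -
      have "0 < n" using that by (cases n) auto
      then show ?thesis
        using that by (auto simp: le_mod_geq le_div_geq less_diff_conv2)
    qed
    show ?case
      unfolding E using F0 ij sub[of i] sub[of j]
      by (cases "i < n"; cases "j < n")
        (auto simp: square_blocks_mat_def div_mod_less)
  next
    case 2
    show ?case using F0 by (simp add: E square_blocks_mat_def del: upt_Suc)
  next
    case 3
    show ?case using F0 by (simp add: E square_blocks_mat_def del: upt_Suc)
  qed
qed

text \<open>In the sum over r that gives block (s, t), the factor on the left vanishes unless r =
  s.\<close>

lemma diag_block_mat_mult_square_blocks:
  assumes F: "\<And>t. t < m \<Longrightarrow> F t \<in> carrier_mat n n"
    and B: "\<And>s t. s < m \<Longrightarrow> t < m \<Longrightarrow> B s t \<in> carrier_mat n n"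
  shows "diag_block_mat (map F [0..<m]) * square_blocks_mat m n B
    = square_blocks_mat m n (\<lambda>s t. F s * B s t)" (is "?l = ?r")
proof (rule eq_matI)
  fix i j assume "i < dim_row ?r" "j < dim_col ?r"
  then have ij: "i < m * n" "j < m * n" by (auto simp: square_blocks_mat_def)
  note dm = div_mod_less[OF ij(1)] div_mod_less[OF ij(2)]
  have D: "diag_block_mat (map F [0..<m])
      = square_blocks_mat m n (\<lambda>s t. if s = t then F s else 0\<^sub>m n n)"
    using F by (rule diag_block_mat_eq_square_blocks)
  have "?l $$ (i, j) = (\<Sum>r<m. ((if i div n = r then F (i div n) else 0\<^sub>m n n) * B r (j div n))
      $$ (i mod n, j mod n))"
    unfolding D
    by (subst square_blocks_mat_mult_index) (use F B ij in auto)
  \<comment> \<open>Moving the case distinction out of the product leaves a sum with a single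
    nonzero term.\<close>
  also have "\<dots> = (\<Sum>r<m. if i div n = r then (F r * B r (j div n)) $$ (i mod n, j mod n) else 0)"
    using dm B by (intro sum.cong) (auto simp: left_mult_zero_mat[of _ n n] right_mult_zero_mat[of _ n n])
  also have "\<dots> = ?r $$ (i, j)"
    using dm ij by (simp add: square_blocks_mat_def)
  finally show "?l $$ (i, j) = ?r $$ (i, j)" .
qed (use diag_block_mat_carrier[of m F n, OF F] in \<open>auto simp: square_blocks_mat_def\<close>)

text \<open>The mirror image: here only r = t survives. Together the two rules turn conjugation by
  block diagonal matrices into conjugation of each block.\<close>

lemma square_blocks_mult_diag_block_mat:
  assumes F: "\<And>t. t < m \<Longrightarrow> F t \<in> carrier_mat n n"
    and B: "\<And>s t. s < m \<Longrightarrow> t < m \<Longrightarrow> B s t \<in> carrier_mat n n"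
  shows "square_blocks_mat m n B * diag_block_mat (map F [0..<m])
    = square_blocks_mat m n (\<lambda>s t. B s t * F t)" (is "?l = ?r")
proof (rule eq_matI)
  fix i j assume "i < dim_row ?r" "j < dim_col ?r"
  then have ij: "i < m * n" "j < m * n" by (auto simp: square_blocks_mat_def)
  note dm = div_mod_less[OF ij(1)] div_mod_less[OF ij(2)]
  have D: "diag_block_mat (map F [0..<m])
      = square_blocks_mat m n (\<lambda>s t. if s = t then F s else 0\<^sub>m n n)"
    using F by (rule diag_block_mat_eq_square_blocks)
  have "?l $$ (i, j) = (\<Sum>r<m. (B (i div n) r * (if r = j div n then F r else 0\<^sub>m n n))
      $$ (i mod n, j mod n))"
    unfolding D
    by (subst square_blocks_mat_mult_index) (use F B ij in auto)
  also have "\<dots> = (\<Sum>r<m. if r = j div n then (B (i div n) r * F r) $$ (i mod n, j mod n) else 0)"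
    using dm B by (intro sum.cong) (auto simp: left_mult_zero_mat[of _ n n] right_mult_zero_mat[of _ n n])
  also have "\<dots> = ?r $$ (i, j)"
    using dm ij by (simp add: square_blocks_mat_def)
  finally show "?l $$ (i, j) = ?r $$ (i, j)" .
qed (use diag_block_mat_carrier[of m F n, OF F] in \<open>auto simp: square_blocks_mat_def\<close>)

text \<open>Applied to the \<open>U t\<close> and their transposes in both orders, this makes the
  block diagonal matrix of the \<open>U t\<close> orthogonal.\<close>

lemma diag_block_mat_mult_eq_one:
  fixes F H :: "nat \<Rightarrow> real mat"
  assumes F: "\<And>t. t < m \<Longrightarrow> F t \<in> carrier_mat n n"
    and H: "\<And>t. t < m \<Longrightarrow> H t \<in> carrier_mat n n"
    and FH: "\<And>t. t < m \<Longrightarrow> F t * H t = 1\<^sub>m n"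
  shows "diag_block_mat (map F [0..<m]) * diag_block_mat (map H [0..<m]) = 1\<^sub>m (m * n)"
proof -
  have "diag_block_mat (map F [0..<m]) * diag_block_mat (map H [0..<m])
    = square_blocks_mat m n (\<lambda>s t. F s * (if s = t then H s else 0\<^sub>m n n))"
    using diag_block_mat_eq_square_blocks[of m H n] F H
    by (simp add: diag_block_mat_mult_square_blocks)
  also have "\<dots> = square_blocks_mat m n (\<lambda>s t. if s = t then 1\<^sub>m n else 0\<^sub>m n n)"
    by (rule square_blocks_mat_cong) (use F FH in \<open>auto simp: right_mult_zero_mat[of _ n n]\<close>)
  also have "\<dots> = 1\<^sub>m (m * n)"
  proof (rule eq_matI)
    fix i j assume "i < dim_row (1\<^sub>m (m * n) :: real mat)" "j < dim_col (1\<^sub>m (m * n) :: real mat)"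
    then have ij: "i < m * n" "j < m * n" by auto
    \<comment> \<open>Quotient and remainder determine an index, so the large identity has identity
      blocks on its diagonal and zero blocks elsewhere.\<close>
    have "i = j \<longleftrightarrow> i div n = j div n \<and> i mod n = j mod n"
      by (metis div_mult_mod_eq)
    then show "square_blocks_mat m n (\<lambda>s t. if s = t then 1\<^sub>m n else 0\<^sub>m n n) $$ (i, j) = 1\<^sub>m (m * n) $$ (i, j)"
      using ij div_mod_less[OF ij(1)] div_mod_less[OF ij(2)]
      by (auto simp: square_blocks_mat_def)
  qed (auto simp: square_blocks_mat_def)
  finally show ?thesis .
qed

section \<open>Eigenvectors of similar matrices\<close>

text \<open>From \<open>A = P * B * P'\<close> and \<open>P' * P = 1\<close> it follows that
  \<open>A * P = P * B\<close>, which carries the eigenvalue equation over. The image of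
  \<open>e\<close> is nonzero because \<open>P'\<close> maps it back to \<open>e\<close>.\<close>

lemma similar_mat_wit_eigenvector:
  fixes A B :: "'a :: field mat"
  assumes sim: "similar_mat_wit A B P P'" and e: "eigenvector B e k"
  shows "eigenvector A (P *\<^sub>v e) k"
proof -
  define n where "n = dim_row A"
  note w = similar_mat_witD[OF n_def sim]
  have ec: "e \<in> carrier_vec n" and e0: "e \<noteq> 0\<^sub>v n" and Be: "B *\<^sub>v e = k \<cdot>\<^sub>v e"
    using e w by (auto simp: eigenvector_def)
  have P'P: "P' *\<^sub>v (P *\<^sub>v e) = e"
    using w ec by (metis assoc_mult_mat_vec one_mult_mat_vec)
  have "A *\<^sub>v (P *\<^sub>v e) = P *\<^sub>v (B *\<^sub>v (P' *\<^sub>v (P *\<^sub>v e)))"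
    using w ec by (simp add: assoc_mult_mat_vec[of _ n n _ n])
  also have "\<dots> = k \<cdot>\<^sub>v (P *\<^sub>v e)"
    using w ec by (simp add: P'P Be mult_mat_vec)
  finally have "A *\<^sub>v (P *\<^sub>v e) = k \<cdot>\<^sub>v (P *\<^sub>v e)" .
  moreover have "P *\<^sub>v e \<noteq> 0\<^sub>v n"
  proof
    assume "P *\<^sub>v e = 0\<^sub>v n"
    then have "e = P' *\<^sub>v 0\<^sub>v n" using P'P by simp
    also have "\<dots> = 0\<^sub>v n" using w by (intro eq_vecI) auto
    finally show False using e0 by simp
  qed
  ultimately show ?thesis
    using w ec by (auto simp: eigenvector_def)
qed

lemma similar_mat_wit_eigenvectors:
  fixes A B :: "'a :: field mat"
  assumes sim: "similar_mat_wit A B P P'"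
  shows "{v. eigenvector A v k} = (\<lambda>e. P *\<^sub>v e) ` {e. eigenvector B e k}"
proof (intro equalityI subsetI)
  fix v assume "v \<in> {v. eigenvector A v k}"
  then have v: "eigenvector A v k" by simp
  \<comment> \<open>The preimage of \<open>v\<close> is \<open>P' *\<^sub>v v\<close>; it is an
    eigenvector of \<open>B\<close> by the previous lemma for the similarity read backwards.\<close>
  note w = similar_mat_witD[OF refl sim]
  have "P *\<^sub>v (P' *\<^sub>v v) = v"
    using w v unfolding eigenvector_def by (metis assoc_mult_mat_vec one_mult_mat_vec)
  moreover have "eigenvector B (P' *\<^sub>v v) k"
    by (rule similar_mat_wit_eigenvector[OF similar_mat_wit_sym[OF sim] v])
  ultimately show "v \<in> (\<lambda>e. P *\<^sub>v e) ` {e. eigenvector B e k}"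
    by (metis image_eqI mem_Collect_eq)
qed (auto intro: similar_mat_wit_eigenvector[OF sim])

section \<open>Block form of the supra-matrices\<close>

lemma laplacian_carrier [simp]: "laplacian n g \<in> carrier_mat n n"
  by (simp add: laplacian_def degree_matrix_def adjacency_matrix_def carrier_matI)

text \<open>Each Kronecker product has an identity factor: one is block diagonal, the other has a
  scalar multiple of the identity in every block. The block diagonal terms combine to the snapshot
  matrices, and the coupling of snapshots remains as scalar blocks.\<close>

lemma M_S_eq_square_blocks:
  "M_S n \<beta> G = square_blocks_mat (length G) n
     (\<lambda>s t. (if s = t then M_snapshot n \<beta> (G ! s) else 0\<^sub>m n n)
        - (\<beta> * path_laplacian (length G) $$ (s, t)) \<cdot>\<^sub>m 1\<^sub>m n)"
proof -
  let ?m = "length G"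
  have "map (laplacian n) G = map (\<lambda>t. laplacian n (G ! t)) [0..<?m]"
    by (rule nth_equalityI) auto
  then have D: "diag_block_mat (map (laplacian n) G)
      = square_blocks_mat ?m n (\<lambda>s t. if s = t then laplacian n (G ! s) else 0\<^sub>m n n)"
    using diag_block_mat_eq_square_blocks[of ?m "\<lambda>t. laplacian n (G ! t)" n] by simp
  \<comment> \<open>\<open>kronecker\<close> divides indices by the dimensions of its second factor,
    so these must be known before entries can be read.\<close>
  have [simp]: "dim_row (complete_laplacian n) = n" "dim_col (complete_laplacian n) = n"
    "dim_row (laplacian n g) = n" "dim_col (laplacian n g) = n"
    "dim_row (path_laplacian k) = k" "dim_col (path_laplacian k) = k" for g k
    by (auto simp: complete_laplacian_def path_laplacian_def laplacian_def degree_matrix_def adjacency_matrix_def)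
  show ?thesis
  proof (rule eq_matI, goal_cases)
    case (1 i j)
    then have ij: "i < ?m * n" "j < ?m * n" by (auto simp: square_blocks_mat_def)
    show ?case
      unfolding M_S_def temporal_laplacian_def temporal_complete_laplacian_def D
      using ij div_mod_less[OF ij(1)] div_mod_less[OF ij(2)]
      by (auto simp: square_blocks_mat_def kronecker_def M_snapshot_def)
  qed (auto simp: M_S_def temporal_laplacian_def temporal_complete_laplacian_def D
      square_blocks_mat_def kronecker_def)
qed

lemma coupling_block_carrier:
  assumes "\<And>t. t < m \<Longrightarrow> U t \<in> carrier_mat n n" "s < m" "t < m"
  shows "coupling_block m n U s t \<in> carrier_mat n n"
  using assms(1)[OF assms(2)] assms(1)[OF assms(3)] by (auto simp: coupling_block_def)

lemma Q_mat_eq_square_blocks: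
  assumes U: "\<And>t. t < m \<Longrightarrow> U t \<in> carrier_mat n n"
    and L: "\<And>t. t < m \<Longrightarrow> \<Lambda> t \<in> carrier_mat n n"
  shows "Q_mat m n \<beta> U \<Lambda> = square_blocks_mat m n
     (\<lambda>s t. (if s = t then \<Lambda> s else 0\<^sub>m n n) - \<beta> \<cdot>\<^sub>m coupling_block m n U s t)" (is "_ = ?r")
proof (rule eq_matI)
  fix i j assume "i < dim_row ?r" "j < dim_col ?r"
  then have ij: "i < m * n" "j < m * n" by (auto simp: square_blocks_mat_def)
  note dm = div_mod_less[OF ij(1)] div_mod_less[OF ij(2)]
  \<comment> \<open>An entry of a difference is read off within the dimensions of the subtrahend,
    here a multiple of the coupling block.\<close>
  have "coupling_block m n U (i div n) (j div n) \<in> carrier_mat n n"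
    using coupling_block_carrier[of m U n, OF U] dm by blast
  then show "Q_mat m n \<beta> U \<Lambda> $$ (i, j) = ?r $$ (i, j)"
    using ij dm diag_block_mat_eq_square_blocks[of m \<Lambda> n] L
    by (auto simp: Q_mat_def square_blocks_mat_def)
qed (auto simp: Q_mat_def square_blocks_mat_def)

text \<open>For neighbouring snapshots the product regroups as
  \<open>-((U s * (U s)\<^sup>T) * (U t * (U t)\<^sup>T))\<close>, which is minus the identity. On
  the diagonal the scalar passes through, and for snapshots further apart both sides are
  zero.\<close>

lemma conjugate_coupling_block:
  assumes U: "\<And>t. t < m \<Longrightarrow> U t \<in> carrier_mat n n"
    and UT: "\<And>t. t < m \<Longrightarrow> U t * transpose_mat (U t) = 1\<^sub>m n"
    and s: "s < m" and t: "t < m"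
  shows "U s * coupling_block m n U s t * transpose_mat (U t)
    = path_laplacian m $$ (s, t) \<cdot>\<^sub>m 1\<^sub>m n"
proof -
  note Us = U[OF s] and Ut = U[OF t]
  have Tt: "transpose_mat (U t) \<in> carrier_mat n n" and Ts: "transpose_mat (U s) \<in> carrier_mat n n"
    using Us Ut by auto
  have P: "transpose_mat (U s) * U t \<in> carrier_mat n n"
    using Ts Ut by simp
  show ?thesis
  proof (cases "s = t")
    case True
    then show ?thesis
      using Ut Tt UT[OF t] by (simp add: coupling_block_def mult_smult_distrib[of _ n n _ n]
          mult_smult_assoc_mat[of _ n n _ n])
  next
    case ne: False
    show ?thesis
    proof (cases "t = Suc s \<or> s = Suc t")
      case True
      have "U s * (transpose_mat (U s) * U t) * transpose_mat (U t)
          = (U s * transpose_mat (U s)) * (U t * transpose_mat (U t))"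
        using Us Ut Ts Tt by (simp add: assoc_mult_mat[of _ n n _ n _ n])
      also have "\<dots> = 1\<^sub>m n"
        by (simp add: UT s t)
      finally have E: "U s * (transpose_mat (U s) * U t) * transpose_mat (U t) = 1\<^sub>m n" .
      have "U s * - (transpose_mat (U s) * U t) * transpose_mat (U t)
          = - (U s * (transpose_mat (U s) * U t) * transpose_mat (U t))"
        using Us Ut Ts Tt P by simp
      also have "\<dots> = (-1) \<cdot>\<^sub>m 1\<^sub>m n"
        unfolding E by auto
      finally show ?thesis
        using True ne path_laplacian_index[OF s t] by (simp add: coupling_block_def)
    next
      case False
      then show ?thesis
        using ne path_laplacian_index[OF s t] Us Tt by (auto simp: coupling_block_def)
    qed
  qed
qed

section \<open>The orthogonal similarity and its spectral consequences\<close>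

text \<open>The witnesses of the similarity are kept explicit because the eigenvector correspondence
  names the transforming matrix.\<close>

lemma M_S_similar_Q_mat:
  assumes m: "m = length G"
    and ed: "\<And>t. t < m \<Longrightarrow> eigendecomposition n (M_snapshot n \<beta> (G ! t)) (U t) (\<Lambda> t)"
  shows "similar_mat_wit (M_S n \<beta> G) (Q_mat m n \<beta> U \<Lambda>)
    (diag_block_mat (map U [0..<m])) (diag_block_mat (map (\<lambda>t. transpose_mat (U t)) [0..<m]))"
proof -
  have U: "U t \<in> carrier_mat n n" and L: "\<Lambda> t \<in> carrier_mat n n"
    and T: "transpose_mat (U t) \<in> carrier_mat n n"
    and TU: "transpose_mat (U t) * U t = 1\<^sub>m n"
    and UT: "U t * transpose_mat (U t) = 1\<^sub>m n"
    and M: "M_snapshot n \<beta> (G ! t) = U t * \<Lambda> t * transpose_mat (U t)" if "t < m" for t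
    using ed[OF that] by (auto simp: eigendecomposition_def)
  define B where "B = (\<lambda>s t. (if s = t then \<Lambda> s else 0\<^sub>m n n) - \<beta> \<cdot>\<^sub>m coupling_block m n U s t)"
  have cc: "coupling_block m n U s t \<in> carrier_mat n n" if "s < m" "t < m" for s t
    using coupling_block_carrier[of m U n, OF U] that by blast
  have Bc: "B s t \<in> carrier_mat n n" if "s < m" "t < m" for s t
    using cc[OF that] L that by (auto simp: B_def)
  have Q: "Q_mat m n \<beta> U \<Lambda> = square_blocks_mat m n B"
    unfolding B_def by (rule Q_mat_eq_square_blocks[of m U n, OF U L])
  \<comment> \<open>Conjugation is linear, so the two parts of the block separate: the
    eigendecomposition restores the snapshot matrix from \<open>\<Lambda> s\<close>, and the
    coupling part becomes the scalar block.\<close>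
  have blk: "U s * B s t * transpose_mat (U t)
      = (if s = t then M_snapshot n \<beta> (G ! s) else 0\<^sub>m n n)
        - (\<beta> * path_laplacian m $$ (s, t)) \<cdot>\<^sub>m 1\<^sub>m n" if st: "s < m" "t < m" for s t
  proof -
    let ?D = "if s = t then \<Lambda> s else 0\<^sub>m n n" and ?C = "coupling_block m n U s t"
    have D: "?D \<in> carrier_mat n n" using L st by auto
    note c = U[OF st(1)] T[OF st(2)] D cc[OF st]
    have "U s * B s t * transpose_mat (U t)
        = U s * ?D * transpose_mat (U t) - U s * (\<beta> \<cdot>\<^sub>m ?C) * transpose_mat (U t)"
      unfolding B_def using c
      by (simp add: mult_minus_distrib_mat[of _ n n _ n] minus_mult_distrib_mat[of _ n n _ _ n])
    also have "U s * (\<beta> \<cdot>\<^sub>m ?C) * transpose_mat (U t)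
        = \<beta> \<cdot>\<^sub>m (U s * ?C * transpose_mat (U t))"
      using c by (simp add: mult_smult_distrib[of _ n n _ n] mult_smult_assoc_mat[of _ n n _ n])
    also have "\<dots> = (\<beta> * path_laplacian m $$ (s, t)) \<cdot>\<^sub>m 1\<^sub>m n"
      using conjugate_coupling_block[of m U n s t] U UT st by auto
    also have "U s * ?D * transpose_mat (U t) = (if s = t then M_snapshot n \<beta> (G ! s) else 0\<^sub>m n n)"
      using c M[OF st(1)] by auto
    finally show ?thesis .
  qed
  have "diag_block_mat (map U [0..<m]) * Q_mat m n \<beta> U \<Lambda>
      * diag_block_mat (map (\<lambda>t. transpose_mat (U t)) [0..<m])
    = square_blocks_mat m n (\<lambda>s t. U s * B s t * transpose_mat (U t))"
    using U T mult_carrier_mat[OF U Bc] Bc diag_block_mat_mult_square_blocks[of m U n B]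
      square_blocks_mult_diag_block_mat[of m "\<lambda>t. transpose_mat (U t)" n "\<lambda>s t. U s * B s t"]
    by (simp add: Q)
  also have "\<dots> = M_S n \<beta> G"
    unfolding M_S_eq_square_blocks m[symmetric]
    by (rule square_blocks_mat_cong) (simp add: blk)
  finally have "M_S n \<beta> G = diag_block_mat (map U [0..<m]) * Q_mat m n \<beta> U \<Lambda>
      * diag_block_mat (map (\<lambda>t. transpose_mat (U t)) [0..<m])" ..
  moreover have "M_S n \<beta> G \<in> carrier_mat (m * n) (m * n)"
    unfolding M_S_eq_square_blocks m[symmetric] by simp
  ultimately show ?thesis
    using diag_block_mat_mult_eq_one[of m U n "\<lambda>t. transpose_mat (U t)", OF U T UT]
      diag_block_mat_mult_eq_one[of m "\<lambda>t. transpose_mat (U t)" n U, OF T U TU]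
      diag_block_mat_carrier[of m U n, OF U]
      diag_block_mat_carrier[of m "\<lambda>t. transpose_mat (U t)" n, OF T]
    by (intro similar_mat_witI[of _ _ "m * n"]) (auto simp: Q)
qed

text \<open>Having the same eigenvalues is expressed both for the sets and, through
  \<open>order\<close> in the characteristic polynomial, for algebraic multiplicities. The image
  equation says that the transformation reaches every eigenvector.\<close>

theorem theorem3:
  fixes n m :: nat and \<beta> :: real and G :: "weighted_graph list"
    and U \<Lambda> :: "nat \<Rightarrow> real mat"
  assumes "temporal_graph_on n G"
    and "m = length G"
    and "\<And>t. t < m \<Longrightarrow> eigendecomposition n (M_snapshot n \<beta> (G ! t)) (U t) (\<Lambda> t)"
  shows "(\<forall>k. eigenvalue (M_S n \<beta> G) k \<longleftrightarrow> eigenvalue (Q_mat m n \<beta> U \<Lambda>) k)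
    \<and> (\<forall>k. order k (char_poly (M_S n \<beta> G)) = order k (char_poly (Q_mat m n \<beta> U \<Lambda>)))
    \<and> (\<forall>k. {v. eigenvector (M_S n \<beta> G) v k}
          = (\<lambda>e. diag_block_mat (map U [0..<m]) *\<^sub>v e) ` {e. eigenvector (Q_mat m n \<beta> U \<Lambda>) e k})"
proof -
  have sim: "similar_mat_wit (M_S n \<beta> G) (Q_mat m n \<beta> U \<Lambda>)
    (diag_block_mat (map U [0..<m])) (diag_block_mat (map (\<lambda>t. transpose_mat (U t)) [0..<m]))"
    using assms(2,3) by (rule M_S_similar_Q_mat)
  have ev: "{v. eigenvector (M_S n \<beta> G) v k}
      = (\<lambda>e. diag_block_mat (map U [0..<m]) *\<^sub>v e) ` {e. eigenvector (Q_mat m n \<beta> U \<Lambda>) e k}" for k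
    by (rule similar_mat_wit_eigenvectors[OF sim])
  \<comment> \<open>An eigenvalue is a number with an eigenvector, and an image is nonempty exactly
    when its source is.\<close>
  have "eigenvalue (M_S n \<beta> G) k \<longleftrightarrow> eigenvalue (Q_mat m n \<beta> U \<Lambda>) k" for k
    using ev[of k] unfolding eigenvalue_def by blast
  moreover have "char_poly (M_S n \<beta> G) = char_poly (Q_mat m n \<beta> U \<Lambda>)"
    using sim by (intro char_poly_similar) (auto simp: similar_mat_def)
  ultimately show ?thesis
    using ev by auto
qed

end
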